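(* Let $n\ge 0$ be an integer, let $a,b,r$ be complex numbers, and fix a choice of sign $\pm$ (with $\mp$ denoting the opposite sign). Let $M^\pm_n(a,b,r)$ be the $(n+1)\times(n+1)$ tridiagonal matrix with rows and columns indexed by $0,1,\ldots,n$, whose entries are $$(M^\pm_n)_{i,i}=\big((n-i)a\pm i b\big)r\ (0\le i\le n),\qquad (M^\pm_n)_{i,i+1}=(i+1)b,\qquad (M^\pm_n)_{i+1,i}=(n-i)a\ (0\le i\le n-1),$$ and all other entries $0$; that is, $$M^\pm_n(a,b,r)=\begin{pmatrix} nar & b & & & & \\ na & ((n-1)a\pm b)r & 2b & & & \\ & (n-1)a & ((n-2)a\pm 2b)r & 3b & & \\ & & (n-2)a & \ddots & \ddots & \\ & & & \ddots & \ddots & nb \\ & & & & a & \pm nbr \end{pmatrix}.$$ Then the eigenvalues of $M^\pm_n(a,b,r)$ (counted with algebraic multiplicity) are $$\frac{1}{2}\left(nr(a\pm b)+(n-2k)\sqrt{4ab+r^2(a\mp b)^2}\right),\qquad k=0,1,\ldots,n,$$ where $\sqrt{4ab+r^2(a\mp b)^2}$ denotes a fixed choice of square root. *)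

theory Defs
  imports Jordan_Normal_Form.Char_Poly
begin

text \<open>
  The sign \<open>\<plusminus>\<close> is encoded by a number \<open>s\<close>, to be taken as \<open>1\<close> or \<open>-1\<close>;
  then \<open>\<minusplus>\<close> is \<open>- s\<close>.
\<close>

definition tridiag_mat :: "complex \<Rightarrow> nat \<Rightarrow> complex \<Rightarrow> complex \<Rightarrow> complex \<Rightarrow> complex mat" where
  "tridiag_mat s n a b r = mat (n + 1) (n + 1) (\<lambda>(i, j).
     if i = j then ((of_nat n - of_nat i) * a + s * of_nat i * b) * r
     else if j = i + 1 then (of_nat i + 1) * b
     else if i = j + 1 then (of_nat n - of_nat j) * a
     else 0)"

text \<open>The multiset of eigenvalues, counted with algebraic multiplicity.\<close>

definition eigenvalue_mset :: "complex mat \<Rightarrow> complex multiset" where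
  "eigenvalue_mset A = proots (char_poly A)"

lemma count_eigenvalue_mset:
  assumes "A \<in> carrier_mat n n"
  shows "count (eigenvalue_mset A) x = order x (char_poly A)"
proof -
  have "char_poly A \<noteq> 0"
    using degree_monic_char_poly[OF assms] by auto
  then show ?thesis
    by (simp add: eigenvalue_mset_def)
qed

lemma set_eigenvalue_mset:
  assumes "A \<in> carrier_mat n n"
  shows "set_mset (eigenvalue_mset A) = {x. eigenvalue A x}"
proof -
  have "char_poly A \<noteq> 0"
    using degree_monic_char_poly[OF assms] by auto
  then show ?thesis
    by (simp add: eigenvalue_mset_def eigenvalue_root_char_poly[OF assms])
qed

end

theory Submission
  imports Defs
begin

text \<open>
  The matrix is the \<open>n\<close>-th symmetric power, in the sense of Lie algebras, of the matrix
  with rows \<open>(p, b)\<close> and \<open>(a, q)\<close>, where \<open>p = a r\<close> and \<open>q = \<plusminus> b r\<close>: it acts on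
  polynomials in \<open>z\<close> of degree at most \<open>n\<close> as a derivation. If \<open>b \<noteq> 0\<close>, the \<open>2 \<times> 2\<close> matrix
  has an eigenvector \<open>(1, t)\<close>, and the basis \<open>z^j (1 + t z)^(n - j)\<close> makes the derivation
  upper bidiagonal with diagonal \<open>(n - j) l + j m\<close>, where \<open>l\<close> and \<open>m\<close> are the eigenvalues
  of the \<open>2 \<times> 2\<close> matrix. If \<open>b = 0\<close>, the matrix is already lower triangular.
\<close>

text \<open>The entries \<open>p\<close> and \<open>q\<close> are free parameters so that the
  triangular matrix obtained by conjugation is again of this shape, with
  \<open>a = 0\<close>.\<close>

definition sym_power_mat :: "nat \<Rightarrow> 'a \<Rightarrow> 'a \<Rightarrow> 'a \<Rightarrow> 'a \<Rightarrow> 'a :: comm_ring_1 mat" where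
  "sym_power_mat n p b a q = mat (n + 1) (n + 1) (\<lambda>(i, j).
     if i = j then (of_nat n - of_nat i) * p + of_nat i * q
     else if j = i + 1 then (of_nat i + 1) * b
     else if i = j + 1 then (of_nat n - of_nat j) * a
     else 0)"

lemma sym_power_mat_carrier [simp]: "sym_power_mat n p b a q \<in> carrier_mat (Suc n) (Suc n)"
  by (simp add: sym_power_mat_def)

lemma tridiag_mat_eq_sym_power_mat:
  "tridiag_mat s n a b r = sym_power_mat n (a * r) b a (s * b * r)"
  unfolding tridiag_mat_def sym_power_mat_def
  by (rule arg_cong[where f = "mat _ _"]) (auto simp: fun_eq_iff algebra_simps)

text \<open>For \<open>j \<le> n\<close> this is the coefficient of \<open>z^i\<close> in
  \<open>z^j (1 + t z)^(n - j)\<close>. Without the test \<open>i < j\<close>, truncated subtraction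
  would give 1 above the diagonal.\<close>

definition shift_coeff :: "nat \<Rightarrow> 'a \<Rightarrow> nat \<Rightarrow> nat \<Rightarrow> 'a :: comm_ring_1" where
  "shift_coeff n t i j = (if i < j then 0 else of_nat ((n - j) choose (i - j)) * t ^ (i - j))"

definition shift_mat :: "nat \<Rightarrow> 'a \<Rightarrow> 'a :: comm_ring_1 mat" where
  "shift_mat n t = mat (n + 1) (n + 1) (\<lambda>(i, j). shift_coeff n t i j)"

lemma shift_mat_carrier [simp]: "shift_mat n t \<in> carrier_mat (Suc n) (Suc n)"
  by (simp add: shift_mat_def)

lemma det_shift_mat: "det (shift_mat n t) = 1"
proof -
  have "diag_mat (shift_mat n t) = replicate (Suc n) 1"
    by (rule nth_equalityI) (auto simp: diag_mat_def shift_mat_def shift_coeff_def simp del: upt_Suc replicate_Suc)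
  moreover have "det (shift_mat n t) = prod_list (diag_mat (shift_mat n t))"
    by (rule det_lower_triangular[of "n + 1"]) (auto simp: shift_mat_def shift_coeff_def)
  ultimately show ?thesis
    by simp
qed

text \<open>Absorption combined with Pascal's rule. The difference is taken in the ring, so
  \<open>e > m\<close> is covered as well: both binomials vanish.\<close>

lemma of_nat_binomial_Suc:
  "(of_nat e + 1) * of_nat (m choose Suc e) = (of_nat m - of_nat e) * (of_nat (m choose e) :: 'a :: comm_ring_1)"
proof -
  have "of_nat (Suc e * (Suc m choose Suc e)) = (of_nat (Suc m * (m choose e)) :: 'a)"
    by (simp only: Suc_times_binomial)
  then show ?thesis
    by (simp add: algebra_simps)
qed

text \<open>The assumption on \<open>t\<close> makes \<open>(1, t)\<close> an eigenvector, so the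
  derivation multiplies \<open>1 + t z\<close> by \<open>p + b t\<close> and sends \<open>z\<close>
  to \<open>b (1 + t z) + (q - b t) z\<close>. The Leibniz rule on
  \<open>z^j (1 + t z)^(n - j)\<close> then gives the identity, read off at
  \<open>z^i\<close>.\<close>

lemma shift_coeff_derivation:
  fixes a b p q t :: "'a :: comm_ring_1"
  assumes t: "b * t\<^sup>2 + (p - q) * t = a" and "j \<le> n"
  shows "((of_nat n - of_nat i) * p + of_nat i * q) * shift_coeff n t i j
       + (of_nat i + 1) * b * shift_coeff n t (i + 1) j
       + (if i = 0 then 0 else (of_nat n - of_nat (i - 1)) * a * shift_coeff n t (i - 1) j)
     = shift_coeff n t i j * ((of_nat n - of_nat j) * (p + b * t) + of_nat j * (q - b * t))
       + (if j = 0 then 0 else shift_coeff n t i (j - 1) * (of_nat j * b))"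
proof (cases "j \<le> i")
  case False
  then show ?thesis
    by (cases "j = i + 1") (auto simp: shift_coeff_def add.commute)
next
  case True
  then obtain e where i: "i = j + e"
    using le_Suc_ex by blast
  obtain m where n: "n = j + m"
    using \<open>j \<le> n\<close> le_Suc_ex by blast
  define C where "C = (of_nat (m choose e) :: 'a)"
  define D where "D = (of_nat (m choose Suc e) :: 'a)"
  have D: "(of_nat e + 1) * D = (of_nat m - of_nat e) * C"
    unfolding C_def D_def by (rule of_nat_binomial_Suc)
  \<comment> \<open>Replacing \<open>a\<close> via \<open>t\<close> raises the exponent
    \<open>e - 1\<close>, so every term becomes a multiple of \<open>t ^ e\<close> or
    \<open>t * t ^ e\<close>.\<close>
  have prev: "(if i = 0 then 0 else (of_nat n - of_nat (i - 1)) * a * shift_coeff n t (i - 1) j)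
      = of_nat e * C * (b * (t * t ^ e) + (p - q) * t ^ e)"
  proof (cases e)
    case 0
    then show ?thesis by (auto simp: i shift_coeff_def)
  next
    case (Suc d)
    have "shift_coeff n t (i - 1) j = of_nat (m choose d) * t ^ d"
      by (simp add: i n Suc shift_coeff_def)
    moreover have "of_nat n - of_nat (i - 1) = (of_nat m - of_nat d :: 'a)"
      by (simp add: i n Suc)
    moreover have "of_nat e * C = (of_nat m - of_nat d) * of_nat (m choose d)"
      using of_nat_binomial_Suc[of d m, where 'a = 'a] by (simp add: Suc C_def add.commute)
    ultimately show ?thesis
      by (simp add: i Suc t[symmetric]) (simp add: algebra_simps power2_eq_square)
  qed
  \<comment> \<open>Pascal's rule splits the binomial \<open>Suc m choose Suc e\<close> of column
    \<open>j - 1\<close>.\<close>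
  have left: "(if j = 0 then 0 else shift_coeff n t i (j - 1) * (of_nat j * b))
      = of_nat j * b * (C + D) * (t * t ^ e)"
    by (cases j) (auto simp: i n shift_coeff_def C_def D_def Suc_diff_le algebra_simps)
  have curr: "shift_coeff n t i j = C * t ^ e"
    by (simp add: i n shift_coeff_def C_def)
  have succ: "shift_coeff n t (i + 1) j = D * (t * t ^ e)"
    by (simp add: i n shift_coeff_def D_def)
  \<comment> \<open>The \<open>t ^ e\<close> terms cancel; what remains is a multiple of the
    recurrence \<open>D\<close>.\<close>
  have "((of_nat n - of_nat i) * p + of_nat i * q) * (C * t ^ e)
       + (of_nat i + 1) * b * (D * (t * t ^ e))
       + of_nat e * C * (b * (t * t ^ e) + (p - q) * t ^ e)
       - C * t ^ e * ((of_nat n - of_nat j) * (p + b * t) + of_nat j * (q - b * t))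
       - of_nat j * b * (C + D) * (t * t ^ e)
     = b * (t * t ^ e) * ((of_nat e + 1) * D - (of_nat m - of_nat e) * C)"
    by (simp add: i n algebra_simps)
  then show ?thesis
    unfolding prev left curr succ D by (simp add: algebra_simps)
qed

lemma sym_power_mat_mult_shift_mat:
  fixes a b p q t :: "'a :: comm_ring_1"
  assumes t: "b * t\<^sup>2 + (p - q) * t = a"
  shows "sym_power_mat n p b a q * shift_mat n t
       = shift_mat n t * sym_power_mat n (p + b * t) b 0 (q - b * t)" (is "?M * ?S = ?S * ?U")
proof (rule eq_matI)
  fix i j assume "i < dim_row (?S * ?U)" "j < dim_col (?S * ?U)"
  then have i: "i < n + 1" and j: "j < n + 1"
    by (auto simp: shift_mat_def sym_power_mat_def)
  let ?c = "shift_coeff n t"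
  let ?d = "(of_nat n - of_nat i) * p + of_nat i * q"
  let ?d' = "(of_nat n - of_nat j) * (p + b * t) + of_nat j * (q - b * t)"
  have "(?M * ?S) $$ (i, j) = (\<Sum>k = 0..<n + 1. ?M $$ (i, k) * ?c k j)"
    using i j by (simp add: scalar_prod_def shift_mat_def sym_power_mat_def del: sum.op_ivl_Suc)
  \<comment> \<open>For \<open>i = 0\<close> the truncated \<open>i - 1\<close> is 0 again; the
    inner test prevents a spurious term at \<open>k = 0\<close>.\<close>
  also have "\<dots> = (\<Sum>k = 0..<n + 1. (if k = i then ?d * ?c i j else 0)
      + (if k = i + 1 then (of_nat i + 1) * b * ?c (i + 1) j else 0)
      + (if k = i - 1 then if i = 0 then 0 else (of_nat n - of_nat (i - 1)) * a * ?c (i - 1) j else 0))"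
    using i by (intro sum.cong) (auto simp: sym_power_mat_def)
  also have "\<dots> = ?d * ?c i j
      + (if i + 1 < n + 1 then (of_nat i + 1) * b * ?c (i + 1) j else 0)
      + (if i = 0 then 0 else (of_nat n - of_nat (i - 1)) * a * ?c (i - 1) j)"
    using i by (simp add: sum.distrib del: sum.op_ivl_Suc)
  \<comment> \<open>Row \<open>n + 1\<close> lies outside the matrix, but its coefficient vanishes
    because the basis polynomials have degree at most \<open>n\<close>.\<close>
  also have "(if i + 1 < n + 1 then (of_nat i + 1) * b * ?c (i + 1) j else 0)
      = (of_nat i + 1) * b * ?c (i + 1) j"
    using i j by (auto simp: shift_coeff_def less_Suc_eq Suc_diff_le binomial_eq_0)
  also have "?d * ?c i j + (of_nat i + 1) * b * ?c (i + 1) j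
      + (if i = 0 then 0 else (of_nat n - of_nat (i - 1)) * a * ?c (i - 1) j)
      = ?c i j * ?d' + (if j = 0 then 0 else ?c i (j - 1) * (of_nat j * b))"
    using t j by (intro shift_coeff_derivation) auto
  also have "\<dots> = (\<Sum>k = 0..<n + 1. (if k = j then ?c i j * ?d' else 0)
      + (if k = j - 1 then if j = 0 then 0 else ?c i (j - 1) * (of_nat j * b) else 0))"
    using j by (simp add: sum.distrib del: sum.op_ivl_Suc)
  also have "\<dots> = (\<Sum>k = 0..<n + 1. ?c i k * ?U $$ (k, j))"
    using j by (intro sum.cong) (auto simp: sym_power_mat_def)
  also have "\<dots> = (?S * ?U) $$ (i, j)"
    using i j by (simp add: scalar_prod_def shift_mat_def sym_power_mat_def del: sum.op_ivl_Suc)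
  finally show "(?M * ?S) $$ (i, j) = (?S * ?U) $$ (i, j)" .
qed (auto simp: shift_mat_def sym_power_mat_def)

lemma similar_mat_if_intertwined:
  fixes A B P :: "'a :: field mat"
  assumes [simp]: "A \<in> carrier_mat n n" "B \<in> carrier_mat n n" "P \<in> carrier_mat n n"
    and "det P \<noteq> 0" and AP: "A * P = P * B"
  shows "similar_mat A B"
proof -
  obtain Q where Q [simp]: "Q \<in> carrier_mat n n" and "Q * P = 1\<^sub>m n" and PQ: "P * Q = 1\<^sub>m n"
    \<comment> \<open>Here \<open>b\<close> only fills the extension slot of the ring record, so any
      value serves.\<close>
    using det_non_zero_imp_unit[of P n, where b = undefined] assms by (auto simp: Units_def ring_mat_def)
  have "A = A * (P * Q)"
    by (simp add: PQ right_mult_one_mat[of A n n])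
  also have "\<dots> = A * P * Q"
    by (rule assoc_mult_mat[symmetric, of _ n n _ n _ n]) auto
  finally have "A = P * B * Q"
    by (simp only: AP)
  show ?thesis
    by (rule similar_matI[of _ _ P Q n]) (simp_all add: PQ \<open>Q * P = 1\<^sub>m n\<close> flip: \<open>A = P * B * Q\<close>)
qed

lemma eigenvalue_mset_upper_triangular:
  assumes "A \<in> carrier_mat n n" "upper_triangular A"
  shows "eigenvalue_mset A = mset (diag_mat A)"
proof -
  have "proots (\<Prod>x\<leftarrow>xs. [:- x, 1:]) = mset xs" for xs :: "complex list"
  proof (induction xs)
    case (Cons x xs)
    have "(\<Prod>x\<leftarrow>xs. [:- x, 1:]) \<noteq> 0"
      by (auto simp: prod_list_zero_iff)
    with Cons show ?case
      by (simp add: proots_mult del: mult_pCons_left)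
  qed simp
  then show ?thesis
    by (simp add: eigenvalue_mset_def char_poly_upper_triangular[OF assms])
qed

lemma mset_diag_sym_power_mat:
  "mset (diag_mat (sym_power_mat n p b a q))
     = {# (of_nat n - of_nat k) * p + of_nat k * q. k \<in># mset_set {0..n} #}"
proof -
  have "diag_mat (sym_power_mat n p b a q)
      = map (\<lambda>k. (of_nat n - of_nat k) * p + of_nat k * q) [0..<n + 1]"
    unfolding diag_mat_def by (auto simp: sym_power_mat_def simp del: upt_Suc)
  then show ?thesis
    by (simp add: atLeastLessThanSuc_atLeastAtMost del: upt_Suc)
qed

lemma image_mset_reflect:
  "{# f (n - k). k \<in># mset_set {0..n} #} = {# f k. k \<in># mset_set {0..n :: nat} #}"
proof -
  have "bij_betw (\<lambda>k. n - k) {0..n} {0..n}"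
    by (rule bij_betw_byWitness[where f' = "\<lambda>k. n - k"]) auto
  then have "image_mset (\<lambda>k. n - k) (mset_set {0..n}) = mset_set {0..n}"
    by (simp add: bij_betw_def image_mset_mset_set)
  then have "image_mset f (image_mset (\<lambda>k. n - k) (mset_set {0..n})) = image_mset f (mset_set {0..n})"
    by simp
  then show ?thesis
    by (simp add: multiset.map_comp comp_def)
qed

lemma eigenvalue_mset_sym_power_mat:
  fixes a b p q w :: complex
  assumes w: "w\<^sup>2 = 4 * a * b + (p - q)\<^sup>2"
  shows "eigenvalue_mset (sym_power_mat n p b a q) =
    {# (of_nat n * (p + q) + (of_nat n - 2 * of_nat k) * w) / 2. k \<in># mset_set {0..n} #}"
    (is "_ = {# ?f k. k \<in># _ #}")
proof (cases "b = 0")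
  case False
  \<comment> \<open>The quadratic formula, \<open>w\<close> being a root of the discriminant; it
    makes \<open>p + b * t\<close> and \<open>q - b * t\<close> equal to
    \<open>(p + q + w) / 2\<close> and \<open>(p + q - w) / 2\<close>.\<close>
  define t where "t = (q - p + w) / (2 * b)"
  have bt: "2 * (b * t) = q - p + w"
    using False by (simp add: t_def)
  then have "4 * b * (b * t\<^sup>2 + (p - q) * t) = (q - p + w) * (q - p + w) + 2 * (p - q) * (q - p + w)"
    by (simp add: power2_eq_square flip: bt) (simp add: algebra_simps)
  also have "\<dots> = 4 * b * a"
    using w by (simp add: power2_eq_square algebra_simps)
  finally have t: "b * t\<^sup>2 + (p - q) * t = a"
    using False by simp
  let ?U = "sym_power_mat n (p + b * t) b 0 (q - b * t)"
  have "similar_mat (sym_power_mat n p b a q) ?U"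
    by (rule similar_mat_if_intertwined[of _ "n + 1" _ "shift_mat n t"])
      (simp_all add: det_shift_mat sym_power_mat_mult_shift_mat[OF t])
  then have "eigenvalue_mset (sym_power_mat n p b a q) = eigenvalue_mset ?U"
    by (simp add: eigenvalue_mset_def char_poly_similar)
  also have "\<dots> = mset (diag_mat ?U)"
    by (rule eigenvalue_mset_upper_triangular[of _ "n + 1"]) (auto simp: sym_power_mat_def)
  also have "\<dots> = {# ?f k. k \<in># mset_set {0..n} #}"
  proof -
    have bt': "b * t = (q - p + w) / 2"
      using bt by (simp add: field_simps)
    show ?thesis
      unfolding mset_diag_sym_power_mat bt' by (intro image_mset_cong) (simp add: field_simps)
  qed
  finally show ?thesis .
next
  case True
  let ?M = "sym_power_mat n p b a q"
  have "eigenvalue_mset ?M = eigenvalue_mset (transpose_mat ?M)"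
    by (simp add: eigenvalue_mset_def char_poly_transpose_mat[of _ "n + 1"])
  also have "\<dots> = mset (diag_mat (transpose_mat ?M))"
    using True by (intro eigenvalue_mset_upper_triangular[of _ "n + 1"]) (auto simp: sym_power_mat_def)
  also have "\<dots> = {# (of_nat n - of_nat k) * p + of_nat k * q. k \<in># mset_set {0..n} #}"
    by (simp add: diag_mat_transpose mset_diag_sym_power_mat
        carrier_matD[OF sym_power_mat_carrier])
  also have "\<dots> = {# ?f k. k \<in># mset_set {0..n} #}"
  proof -
    \<comment> \<open>The root \<open>w\<close> is prescribed, so both signs must be
      treated.\<close>
    consider "w = p - q" | "w = q - p"
      using w True by (auto simp: power2_eq_iff)
    then show ?thesis
    proof cases
      case 1
      show ?thesis
        unfolding 1 by (intro image_mset_cong) (simp add: field_simps)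
    next
      case 2
      \<comment> \<open>This sign lists the diagonal backwards, hence the reflection of the
        index.\<close>
      have "{# ?f (n - k). k \<in># mset_set {0..n} #}
          = {# (of_nat n - of_nat k) * p + of_nat k * q. k \<in># mset_set {0..n} #}"
        unfolding 2 by (intro image_mset_cong) (auto simp: of_nat_diff field_simps)
      then show ?thesis
        using image_mset_reflect[of ?f n] by simp
    qed
  qed
  finally show ?thesis .
qed

theorem theorem2:
  fixes n :: nat and a b r s w :: complex
  assumes sign: "s = 1 \<or> s = -1"
    and root: "w\<^sup>2 = 4 * a * b + r\<^sup>2 * (a - s * b)\<^sup>2"
  shows "eigenvalue_mset (tridiag_mat s n a b r) =
    {# (of_nat n * r * (a + s * b) + (of_nat n - 2 * of_nat k) * w) / 2. k \<in># mset_set {0..n} #}"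
proof -
  have "w\<^sup>2 = 4 * a * b + (a * r - s * b * r)\<^sup>2"
    unfolding root by (simp add: power2_eq_square algebra_simps)
  from eigenvalue_mset_sym_power_mat[OF this] show ?thesis
    by (simp add: tridiag_mat_eq_sym_power_mat algebra_simps)
qed

end
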